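(* Let $G=\mathbb{R}^3=\{(x,y,z)\}$ be the Heisenberg group with the left-invariant vector fields $$X_1=\frac{\partial}{\partial x}-\frac y2\frac{\partial}{\partial z},\qquad X_2=\frac{\partial}{\partial y}+\frac x2\frac{\partial}{\partial z},\qquad X_3=\frac{\partial}{\partial z},$$ and consider the control system $$\dot q=\sum_{i=1}^3u_iX_i(q),\qquad q\in G,$$ $$u\in U=\{(u_1,u_2,u_3)\in\mathbb{R}^3\mid -u_1^2+u_2^2+u_3^2\le 0,\ u_1\ge 0\},$$ with the length functional $$J(q(\cdot))=\int_0^{t_1}\sqrt{u_1^2-u_2^2-u_3^2}\,dt.$$ For every $q_0\in G$ and every $q_1\in\mathcal{A}_{q_0}$ there exists a Lorentzian longest curve connecting $q_0$ to $q_1$, i.e. an admissible trajectory from $q_0$ to $q_1$ on which $J$ attains its maximum among all admissible trajectories from $q_0$ to $q_1$.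
   Context: In coordinates the system is $\dot x=u_1$, $\dot y=u_2$, $\dot z=-\frac y2u_1+\frac x2u_2+u_3$. An admissible trajectory is a Lipschitz curve $q:[0,t_1]\to G$, $t_1\ge 0$ (the terminal time $t_1$ is free), satisfying $\dot q(t)=\sum_{i=1}^3u_i(t)X_i(q(t))$ for almost every $t$, with a measurable essentially bounded control $u:[0,t_1]\to U$. The attainable set $\mathcal{A}_{q_0}$ is the set of all endpoints $q(t_1)$ of admissible trajectories with $q(0)=q_0$, over all $t_1\ge 0$. *)

theory Defs
  imports "HOL-Analysis.Analysis"
begin

type_synonym heis = "real ^ 3"

definition X1 :: "heis \<Rightarrow> real ^ 3" where
  "X1 q = vector [1, 0, - (q $ 2) / 2]"

definition X2 :: "heis \<Rightarrow> real ^ 3" where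
  "X2 q = vector [0, 1, q $ 1 / 2]"

definition X3 :: "heis \<Rightarrow> real ^ 3" where
  "X3 q = vector [0, 0, 1]"

definition control_set :: "(real ^ 3) set" where
  "control_set = {u. - (u $ 1)\<^sup>2 + (u $ 2)\<^sup>2 + (u $ 3)\<^sup>2 \<le> 0 \<and> u $ 1 \<ge> 0}"

(* Only the values of q and u on {0..t1} matter.  The one-sided derivatives at the two
   end points are irrelevant, since these form a null set. *)
definition admissible :: "real \<Rightarrow> (real \<Rightarrow> heis) \<Rightarrow> (real \<Rightarrow> real ^ 3) \<Rightarrow> bool" where
  "admissible t1 q u \<longleftrightarrow>
     0 \<le> t1 \<and>
     (\<exists>L. L-lipschitz_on {0..t1} q) \<and>
     u \<in> borel_measurable (lebesgue_on {0..t1}) \<and>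
     (\<exists>C. AE t in lebesgue_on {0..t1}. norm (u t) \<le> C) \<and>
     (\<forall>t\<in>{0..t1}. u t \<in> control_set) \<and>
     (AE t in lebesgue_on {0..t1}.
        (q has_vector_derivative
           (u t $ 1 *\<^sub>R X1 (q t) + u t $ 2 *\<^sub>R X2 (q t) + u t $ 3 *\<^sub>R X3 (q t)))
        (at t within {0..t1}))"

definition admissible_from_to ::
  "heis \<Rightarrow> heis \<Rightarrow> real \<Rightarrow> (real \<Rightarrow> heis) \<Rightarrow> (real \<Rightarrow> real ^ 3) \<Rightarrow> bool" where
  "admissible_from_to q0 q1 t1 q u \<longleftrightarrow> admissible t1 q u \<and> q 0 = q0 \<and> q t1 = q1"

definition attainable_set :: "heis \<Rightarrow> heis set" where
  "attainable_set q0 = {q1. \<exists>t1 q u. admissible_from_to q0 q1 t1 q u}"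

(* X1, X2, X3 are pointwise linearly independent, so a trajectory q determines its control u
   almost everywhere; hence the length of q is well defined as a function of u.  For admissible u
   the integrand is bounded and measurable, so the Bochner integral is a genuine one. *)
definition J :: "real \<Rightarrow> (real \<Rightarrow> real ^ 3) \<Rightarrow> real" where
  "J t1 u = (LINT t|lebesgue_on {0..t1}. sqrt ((u t $ 1)\<^sup>2 - (u t $ 2)\<^sup>2 - (u t $ 3)\<^sup>2))"

definition longest_curve ::
  "heis \<Rightarrow> heis \<Rightarrow> real \<Rightarrow> (real \<Rightarrow> heis) \<Rightarrow> (real \<Rightarrow> real ^ 3) \<Rightarrow> bool" where
  "longest_curve q0 q1 t1 q u \<longleftrightarrow>
     admissible_from_to q0 q1 t1 q u \<and>
     (\<forall>t1' q' u'. admissible_from_to q0 q1 t1' q' u' \<longrightarrow> J t1' u' \<le> J t1 u)"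

end

(*
  Lagrange duality instead of weak compactness.  With w = z + xy/2 one has w' = x u2 + u3, so once
  curves are parametrised by x the endpoint conditions are two linear constraints on (u2, u3), whose
  multipliers are l and m.  By Cauchy-Schwarz,
    sqrt (u1^2 - u2^2 - u3^2) + (l + m x) u2 + m u3 <= sqrt (1 + (l + m x)^2 + m^2) u1  on U,
  and integrating along a trajectory bounds J by a function D(l, m) of the end points alone.
  Dropping the 1 under the root gives a positively homogeneous H <= D, nonnegative because a
  trajectory exists.  If H vanishes at some (l, m) other than (0, 0), every trajectory is lightlike
  and J = 0 throughout.  Otherwise D is coercive and has a minimum, and stationarity there says
  exactly that the curve with u1 = 1 and equality in Cauchy-Schwarz has the right end point.
*)

theory Submission
  imports Defs
begin

section \<open>Fundamental theorem of calculus for Lipschitz functions\<close>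

text \<open>Serves twice: for the pointwise limit of the difference quotients of a Lipschitz
  function, and for the limit of the averages into which their integrals telescope.\<close>

lemma has_real_derivative_right_sequence:
  fixes f :: "real \<Rightarrow> real"
  assumes f: "(f has_real_derivative D) (at t within {a..b})" and t: "a \<le> t" "t < b"
  shows "(\<lambda>n. (f (t + 1 / Suc n) - f t) * Suc n) \<longlonglongrightarrow> D"
proof -
  have lim: "(\<lambda>n. t + 1 / Suc n) \<longlonglongrightarrow> t"
    using tendsto_add[OF tendsto_const LIMSEQ_Suc[OF lim_1_over_n], of t] by simp
  have "\<forall>\<^sub>F n in sequentially. t + 1 / Suc n < b"
    using lim t(2) by (rule order_tendstoD)
  then have "\<forall>\<^sub>F n in sequentially. t + 1 / Suc n \<in> {a..b} \<and> t + 1 / Suc n \<noteq> t"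
    by (rule eventually_mono) (use t in \<open>auto intro: order_trans[of a t]\<close>)
  then have "filterlim (\<lambda>n. t + 1 / Suc n) (at t within {a..b}) sequentially"
    using lim by (simp add: filterlim_at)
  from filterlim_compose[OF f[unfolded has_field_derivative_iff] this]
  show ?thesis by (simp add: field_simps)
qed

text \<open>The difference quotients are bounded by the Lipschitz constant, so dominated convergence applies,
  and their integrals telescope to averages of f near the two end points.\<close>

lemma LINT_derivative_lipschitz:
  fixes f g :: "real \<Rightarrow> real"
  assumes T: "0 \<le> T" and lip: "L-lipschitz_on {0..T} f"
    and meas: "g \<in> borel_measurable (lebesgue_on {0..T})"
    and der: "AE t in lebesgue_on {0..T}. (f has_real_derivative g t) (at t within {0..T})"
  shows "integrable (lebesgue_on {0..T}) g" "(LINT t|lebesgue_on {0..T}. g t) = f T - f 0"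
proof -
  \<comment> \<open>Extending \<open>f\<close> by constants keeps the constant \<open>L\<close> and
    makes every quotient \<open>h n t\<close> meaningful, even where \<open>t + 1 / Suc n\<close>
    exceeds \<open>T\<close>.\<close>
  define e where "e t = f (max 0 (min T t))" for t
  define h where "h n t = (e (t + 1 / Suc n) - e t) * Suc n" for n t
  have L: "\<bar>e s - e t\<bar> \<le> L * \<bar>s - t\<bar>" for s t
  proof -
    have "\<bar>e s - e t\<bar> \<le> L * \<bar>max 0 (min T s) - max 0 (min T t)\<bar>"
      unfolding e_def using lipschitz_onD[OF lip] T by (auto simp: dist_real_def)
    also have "\<dots> \<le> L * \<bar>s - t\<bar>"
      using lipschitz_on_nonneg[OF lip] by (intro mult_left_mono) auto
    finally show ?thesis .
  qed
  have "L-lipschitz_on UNIV e"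
    using L lipschitz_on_nonneg[OF lip] by (auto intro!: lipschitz_onI simp: dist_real_def)
  then have cont: "continuous_on S e" for S
    by (meson lipschitz_on_continuous_on continuous_on_subset subset_UNIV)
  have conth: "continuous_on {0..T} (h n)" for n
    unfolding h_def by (intro continuous_intros continuous_on_compose2[OF cont[of UNIV]]) auto
  have meash: "h n \<in> borel_measurable (lebesgue_on {0..T})" for n
    by (rule continuous_imp_measurable_on_sets_lebesgue[OF conth]) auto
  have bound: "norm (h n t) \<le> L" for n t
    using mult_right_mono[OF L[of "t + 1 / Suc n" t], of "Suc n"] by (simp add: h_def abs_mult)
  \<comment> \<open>At \<open>T\<close> itself the right quotients of \<open>e\<close> see only the
    constant extension, so this point is discarded as a null set.\<close>
  have ae: "AE t in lebesgue_on {0..T}. t \<noteq> T"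
    by (rule AE_I'[of "{T}"]) (auto simp: null_sets_restrict_space T)
  have lim: "AE t in lebesgue_on {0..T}. (\<lambda>n. h n t) \<longlonglongrightarrow> g t"
    using der ae AE_space
  proof eventually_elim
    case (elim t)
    then have t: "0 \<le> t" "t < T" by auto
    have "(e has_real_derivative g t) (at t within {0..T})"
      by (rule has_field_derivative_transform_within[OF elim(1) zero_less_one]) (use t in \<open>auto simp: e_def\<close>)
    from has_real_derivative_right_sequence[OF this t] show ?case
      by (simp add: h_def)
  qed
  have intL: "integrable (lebesgue_on {0..T}) (\<lambda>_. L)"
    by (simp add: T)
  note dct = meas meash intL lim AE_I2[OF bound]
  show "integrable (lebesgue_on {0..T}) g"
    by (rule integrable_dominated_convergence[OF dct])
  have A: "(\<lambda>n. LINT t|lebesgue_on {0..T}. h n t) \<longlonglongrightarrow> (LINT t|lebesgue_on {0..T}. g t)"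
    by (rule integral_dominated_convergence[OF dct])
  define \<Psi> where "\<Psi> s = integral {0..s} e" for s
  have ie: "e integrable_on {c..d}" for c d
    by (rule integrable_continuous_real[OF cont])
  \<comment> \<open>The interval reaches beyond \<open>T\<close> so that right quotients are
    available at \<open>T\<close> as well as at 0.\<close>
  have \<Psi>: "(\<Psi> has_real_derivative e s) (at s within {0..T+1})" if "s \<in> {0..T+1}" for s
    unfolding \<Psi>_def by (rule integral_has_real_derivative[OF cont that])
  \<comment> \<open>Shifting the first integral by \<open>1 / Suc n\<close> cancels the overlap and
    leaves the averages of \<open>e\<close> just after \<open>T\<close> and just after 0.\<close>
  have "(LINT t|lebesgue_on {0..T}. h n t)
      = (\<Psi> (T + 1 / Suc n) - \<Psi> T) * Suc n - (\<Psi> (0 + 1 / Suc n) - \<Psi> 0) * Suc n" for n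
  proof -
    let ?d = "1 / real (Suc n)"
    have "(LINT t|lebesgue_on {0..T}. h n t) = integral {0..T} (h n)"
      by (rule lebesgue_integral_eq_integral) (use continuous_imp_integrable_real[OF conth] in auto)
    also have "\<dots> = (integral {0..T} (\<lambda>t. e (t + ?d)) - integral {0..T} e) * Suc n"
      unfolding h_def
      by (subst integral_mult_left, subst integral_diff)
         (auto intro!: integrable_continuous_real continuous_on_compose2[OF cont[of UNIV]] continuous_intros ie)
    also have "integral {0..T} (\<lambda>t. e (t + ?d)) = integral {?d..T + ?d} e"
      using integral_shift_real_ivl[of ?d ?d "T + ?d" e] by (simp add: add.commute)
    also have "\<dots> = \<Psi> (T + ?d) - \<Psi> ?d"
      using Henstock_Kurzweil_Integration.integral_combine[of 0 ?d "T + ?d" e] ie T unfolding \<Psi>_def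
      by simp
    finally show ?thesis by (simp add: \<Psi>_def algebra_simps)
  qed
  moreover have "(\<lambda>n. (\<Psi> (T + 1 / Suc n) - \<Psi> T) * Suc n - (\<Psi> (0 + 1 / Suc n) - \<Psi> 0) * Suc n)
      \<longlonglongrightarrow> e T - e 0"
    by (intro tendsto_diff has_real_derivative_right_sequence[OF \<Psi>]) (use T in auto)
  ultimately show "(LINT t|lebesgue_on {0..T}. g t) = f T - f 0"
    using A T LIMSEQ_unique by (fastforce simp: e_def)
qed

section \<open>Regularity and derivatives of the coordinates of a trajectory\<close>

lemma lipschitz_on_mult_bounded:
  fixes f g :: "'a::metric_space \<Rightarrow> real"
  assumes f: "K-lipschitz_on S f" and g: "M-lipschitz_on S g"
    and A: "\<And>x. x \<in> S \<Longrightarrow> \<bar>f x\<bar> \<le> A" "0 \<le> A" and B: "\<And>x. x \<in> S \<Longrightarrow> \<bar>g x\<bar> \<le> B" "0 \<le> B"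
  shows "(A * M + B * K)-lipschitz_on S (\<lambda>x. f x * g x)"
proof (rule lipschitz_onI)
  show "0 \<le> A * M + B * K"
    using lipschitz_on_nonneg[OF f] lipschitz_on_nonneg[OF g] A B by simp
next
  fix x y assume xy: "x \<in> S" "y \<in> S"
  have "\<bar>f x * g x - f y * g y\<bar> = \<bar>f x * (g x - g y) + g y * (f x - f y)\<bar>"
    by (simp add: algebra_simps)
  also have "\<dots> \<le> \<bar>f x\<bar> * \<bar>g x - g y\<bar> + \<bar>g y\<bar> * \<bar>f x - f y\<bar>"
    by (metis abs_mult abs_triangle_ineq)
  also have "\<dots> \<le> A * (M * dist x y) + B * (K * dist x y)"
    using lipschitz_onD[OF f xy] lipschitz_onD[OF g xy] A(1)[OF xy(1)] B(1)[OF xy(2)] A(2) B(2)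
    by (intro add_mono mult_mono) (auto simp: dist_real_def)
  finally show "dist (f x * g x) (f y * g y) \<le> (A * M + B * K) * dist x y"
    by (simp add: dist_real_def algebra_simps)
qed

lemma lipschitz_on_vec_nth:
  fixes q :: "'a::metric_space \<Rightarrow> real ^ 'n"
  assumes "L-lipschitz_on S q"
  shows "L-lipschitz_on S (\<lambda>t. q t $ i)"
  using assms unfolding lipschitz_on_def by (meson dist_vec_nth_le order_trans)

lemma borel_measurable_vec_nth [measurable (raw)]:
  fixes u :: "'a \<Rightarrow> real ^ 'n"
  assumes "u \<in> borel_measurable M"
  shows "(\<lambda>t. u t $ i) \<in> borel_measurable M"
  using measurable_compose[OF assms
      borel_measurable_continuous_onI[OF linear_continuous_on[OF bounded_linear_vec_nth]]] .

lemma horizontal_derivative_components: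
  fixes u :: "real ^ 3"
  assumes "(q has_vector_derivative (u $ 1 *\<^sub>R X1 (q t) + u $ 2 *\<^sub>R X2 (q t) + u $ 3 *\<^sub>R X3 (q t)))
             (at t within S)"
  shows "((\<lambda>t. q t $ 1) has_real_derivative u $ 1) (at t within S)"
    and "((\<lambda>t. q t $ 2) has_real_derivative u $ 2) (at t within S)"
    and "((\<lambda>t. q t $ 3) has_real_derivative
           - (q t $ 2) / 2 * u $ 1 + q t $ 1 / 2 * u $ 2 + u $ 3) (at t within S)"
  using bounded_linear.has_vector_derivative[OF bounded_linear_vec_nth assms, of 1]
    bounded_linear.has_vector_derivative[OF bounded_linear_vec_nth assms, of 2]
    bounded_linear.has_vector_derivative[OF bounded_linear_vec_nth assms, of 3]
  by (simp_all add: has_real_derivative_iff_has_vector_derivative X1_def X2_def X3_def mult.commute)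

section \<open>The dual function as an upper bound for the length\<close>

text \<open>This is w of the overview: the added product cancels the term with y in the equation for
  z.\<close>

definition sheared_height :: "heis \<Rightarrow> real" where
  "sheared_height q = q $ 3 + q $ 1 * q $ 2 / 2"

text \<open>The parameter e switches between the duality bound (e = 1) and its homogeneous part (e = 0).\<close>

definition dual_norm :: "real \<Rightarrow> real \<Rightarrow> real \<Rightarrow> real \<Rightarrow> real" where
  "dual_norm e l m s = sqrt (e\<^sup>2 + (l + m * s)\<^sup>2 + m\<^sup>2)"

text \<open>D(l, m) of the overview for \<open>e = 1\<close>, and H(l, m) for
  \<open>e = 0\<close>.\<close>

definition dual_value :: "heis \<Rightarrow> heis \<Rightarrow> real \<Rightarrow> real \<Rightarrow> real \<Rightarrow> real" where
  "dual_value q0 q1 e l m = integral {q0 $ 1..q1 $ 1} (dual_norm e l m)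
     - l * (q1 $ 2 - q0 $ 2) - m * (sheared_height q1 - sheared_height q0)"

lemma continuous_on_dual_norm [continuous_intros]:
  assumes "continuous_on S f" "continuous_on S g" "continuous_on S h"
  shows "continuous_on S (\<lambda>x. dual_norm e (f x) (g x) (h x))"
  unfolding dual_norm_def using assms by (intro continuous_intros) auto

lemma dual_norm_nonneg: "0 \<le> dual_norm e l m s"
  by (simp add: dual_norm_def)

text \<open>The first coordinate grows at rate \<open>u t $ 1\<close>, which is nonnegative on the
  cone. Hence the interval of integration in \<open>dual_value\<close> is correctly
  oriented.\<close>

lemma trajectory_monotone:
  assumes "admissible_from_to q0 q1 T q u"
  shows "q0 $ 1 \<le> q1 $ 1"
proof -
  from assms obtain L where T: "0 \<le> T" and L: "L-lipschitz_on {0..T} q"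
    and [measurable]: "u \<in> borel_measurable (lebesgue_on {0..T})"
    and c: "\<And>t. t \<in> {0..T} \<Longrightarrow> u t \<in> control_set"
    and d: "AE t in lebesgue_on {0..T}. (q has_vector_derivative
           (u t $ 1 *\<^sub>R X1 (q t) + u t $ 2 *\<^sub>R X2 (q t) + u t $ 3 *\<^sub>R X3 (q t)))
        (at t within {0..T})"
    and q: "q 0 = q0" "q T = q1"
    by (auto simp: admissible_from_to_def admissible_def)
  have "AE t in lebesgue_on {0..T}. ((\<lambda>t. q t $ 1) has_real_derivative u t $ 1) (at t within {0..T})"
    using d by eventually_elim (rule horizontal_derivative_components)
  from LINT_derivative_lipschitz(2)[OF T lipschitz_on_vec_nth[OF L] borel_measurable_vec_nth this]
  have "(LINT t|lebesgue_on {0..T}. u t $ 1) = q1 $ 1 - q0 $ 1"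
    by (simp add: q)
  moreover have "0 \<le> (LINT t|lebesgue_on {0..T}. u t $ 1)"
    by (rule integral_nonneg_AE, rule AE_I2) (use c in \<open>auto simp: control_set_def\<close>)
  ultimately show ?thesis by simp
qed

text \<open>The integrand \<open>g\<close> is the derivative along the trajectory of a function of
  position alone, so its integral depends only on the end points. This replaces a change of
  variables from t to x, which need not be injective.\<close>

lemma trajectory_dual_value:
  fixes e l m :: real
  assumes "admissible_from_to q0 q1 T q u"
  defines "g \<equiv> \<lambda>t. dual_norm e l m (q t $ 1) * u t $ 1 - (l + m * q t $ 1) * u t $ 2 - m * u t $ 3"
  shows "integrable (lebesgue_on {0..T}) g"
    and "(LINT t|lebesgue_on {0..T}. g t) = dual_value q0 q1 e l m"
proof -
  from assms(1) obtain L where T: "0 \<le> T" and L: "L-lipschitz_on {0..T} q"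
    and [measurable]: "u \<in> borel_measurable (lebesgue_on {0..T})"
    and d: "AE t in lebesgue_on {0..T}. (q has_vector_derivative
           (u t $ 1 *\<^sub>R X1 (q t) + u t $ 2 *\<^sub>R X2 (q t) + u t $ 3 *\<^sub>R X3 (q t)))
        (at t within {0..T})"
    and q: "q 0 = q0" "q T = q1"
    by (auto simp: admissible_from_to_def admissible_def)
  have cq: "continuous_on {0..T} q"
    by (rule lipschitz_on_continuous_on[OF L])
  then have "bounded (q ` {0..T})"
    by (intro compact_imp_bounded compact_continuous_image) auto
  then obtain M0 where M0: "\<And>t. t \<in> {0..T} \<Longrightarrow> norm (q t) \<le> M0"
    unfolding bounded_iff by blast
  \<comment> \<open>The extra 1 keeps the coordinates strictly inside \<open>{-M..M}\<close>, where
    the one-sided derivative of \<open>G\<close> becomes a two-sided one and the chain rule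
    applies.\<close>
  define M where "M = max M0 0 + 1"
  have M: "0 \<le> M" "\<bar>q t $ i\<bar> < M" if "t \<in> {0..T}" for t i
    using M0[OF that] component_le_norm_cart[of "q t" i] by (auto simp: M_def)
  have M1: "\<bar>q t $ i\<bar> \<le> M" if "t \<in> {0..T}" for t i
    using M(2)[OF that] by (simp add: less_imp_le)
  have cN: "continuous_on S (dual_norm e l m)" for S
    by (intro continuous_on_dual_norm continuous_on_const continuous_on_id)
  then obtain G where G: "\<And>s. s \<in> {-M..M} \<Longrightarrow> (G has_vector_derivative dual_norm e l m s) (at s within {-M..M})"
    using antiderivative_continuous by blast
  have "bounded (dual_norm e l m ` {-M..M})"
    by (intro compact_imp_bounded compact_continuous_image cN) auto
  then obtain K where K: "\<And>s. s \<in> {-M..M} \<Longrightarrow> \<bar>dual_norm e l m s\<bar> \<le> K"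
    unfolding bounded_iff real_norm_def by blast
  have K0: "0 \<le> K"
    using K[of 0] M(1)[of 0] T by force
  have GL: "K-lipschitz_on {-M..M} G"
    by (rule bounded_derivative_imp_lipschitz[OF G[unfolded has_vector_derivative_def]])
       (use K K0 in \<open>auto intro!: onorm_le mult_left_mono simp: abs_mult mult.commute[of K]\<close>)
  \<comment> \<open>The potential behind \<open>g\<close>: an antiderivative of
    \<open>dual_norm\<close> in x, minus the multipliers times y and the sheared height.\<close>
  define F where "F t = G (q t $ 1) - l * q t $ 2 - m * (q t $ 3 + q t $ 1 * q t $ 2 / 2)" for t
  have x: "(\<lambda>t. q t $ i) ` {0..T} \<subseteq> {-M..M}" for i
  proof (rule image_subsetI)
    show "q t $ i \<in> {-M..M}" if "t \<in> {0..T}" for t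
      using M1[OF that, of i] by auto
  qed
  have "\<exists>C. C-lipschitz_on {0..T} F"
  proof
    have "(K * L)-lipschitz_on {0..T} (\<lambda>t. G (q t $ 1))"
      by (rule lipschitz_on_compose2[OF lipschitz_on_vec_nth[OF L] lipschitz_on_subset[OF GL x]])
    moreover have "(M * L + M * L)-lipschitz_on {0..T} (\<lambda>t. q t $ 1 * q t $ 2)"
      by (rule lipschitz_on_mult_bounded) (use M1 lipschitz_on_vec_nth[OF L] M(1) T in auto)
    ultimately have "(K * L + \<bar>- l\<bar> * L + \<bar>- m\<bar> * L + \<bar>- m / 2\<bar> * (M * L + M * L))-lipschitz_on {0..T}
        (\<lambda>t. G (q t $ 1) + - l * q t $ 2 + - m * q t $ 3 + - m / 2 * (q t $ 1 * q t $ 2))"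
      by (intro lipschitz_on_add lipschitz_on_cmult_real lipschitz_on_vec_nth[OF L])
    then show "(K * L + \<bar>- l\<bar> * L + \<bar>- m\<bar> * L + \<bar>- m / 2\<bar> * (M * L + M * L))-lipschitz_on {0..T} F"
      by (simp add: F_def algebra_simps)
  qed
  then obtain C where C: "C-lipschitz_on {0..T} F" ..
  have dF: "AE t in lebesgue_on {0..T}. (F has_real_derivative g t) (at t within {0..T})"
    using d AE_space
  proof eventually_elim
    case (elim t)
    then have t: "t \<in> {0..T}" by simp
    note D = horizontal_derivative_components[OF elim(1)]
    have "(G has_real_derivative dual_norm e l m (q t $ 1)) (at (q t $ 1))"
      using G[of "q t $ 1"] M(2)[OF t, of 1] unfolding abs_less_iff
      by (simp add: at_within_Icc_at has_real_derivative_iff_has_vector_derivative)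
    from DERIV_chain2[OF this D(1)]
    show ?case
      unfolding F_def g_def
      by (auto intro!: derivative_eq_intros D simp: field_simps)
  qed
  have cx: "continuous_on {0..T} (\<lambda>t. q t $ 1)"
    by (intro continuous_intros cq)
  have "(\<lambda>t. q t $ 1) \<in> borel_measurable (lebesgue_on {0..T})"
    "(\<lambda>t. dual_norm e l m (q t $ 1)) \<in> borel_measurable (lebesgue_on {0..T})"
    using continuous_on_compose2[OF cN[of UNIV] cx] cx
    by (auto intro!: continuous_imp_measurable_on_sets_lebesgue)
  note [measurable] = this
  have gm: "g \<in> borel_measurable (lebesgue_on {0..T})"
    unfolding g_def by measurable
  show "integrable (lebesgue_on {0..T}) g"
    by (rule LINT_derivative_lipschitz[OF T C gm dF])
  have le: "q0 $ 1 \<le> q1 $ 1"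
    by (rule trajectory_monotone[OF assms(1)])
  have "{q0 $ 1..q1 $ 1} \<subseteq> {-M..M}"
    using M1[of 0 1] M1[of T 1] q T by auto
  then have "(dual_norm e l m has_integral G (q1 $ 1) - G (q0 $ 1)) {q0 $ 1..q1 $ 1}"
    by (intro fundamental_theorem_of_calculus[OF le])
       (meson G has_vector_derivative_within_subset subsetD)
  then show "(LINT t|lebesgue_on {0..T}. g t) = dual_value q0 q1 e l m"
    unfolding LINT_derivative_lipschitz(2)[OF T C gm dF]
    by (simp add: F_def q dual_value_def sheared_height_def integral_unique algebra_simps)
qed

text \<open>Cauchy-Schwarz for the vectors (e, l + m s, m) and (A, u2, u3), where A is the
  Lorentzian length of the control; the second vector has Euclidean norm u1.\<close>

lemma dual_norm_control_bound:
  assumes "u \<in> control_set"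
  shows "e * sqrt ((u $ 1)\<^sup>2 - (u $ 2)\<^sup>2 - (u $ 3)\<^sup>2) + (l + m * s) * u $ 2 + m * u $ 3
    \<le> dual_norm e l m s * u $ 1"
proof -
  define A where "A = sqrt ((u $ 1)\<^sup>2 - (u $ 2)\<^sup>2 - (u $ 3)\<^sup>2)"
  define p where "p = l + m * s"
  have A: "A\<^sup>2 = (u $ 1)\<^sup>2 - (u $ 2)\<^sup>2 - (u $ 3)\<^sup>2" and u1: "0 \<le> u $ 1"
    using assms by (auto simp: A_def control_set_def)
  \<comment> \<open>Lagrange's identity: the defect in Cauchy-Schwarz is a sum of squares.\<close>
  have "(e\<^sup>2 + p\<^sup>2 + m\<^sup>2) * (A\<^sup>2 + (u $ 2)\<^sup>2 + (u $ 3)\<^sup>2) - (e * A + p * u $ 2 + m * u $ 3)\<^sup>2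
      = (e * u $ 2 - p * A)\<^sup>2 + (e * u $ 3 - m * A)\<^sup>2 + (p * u $ 3 - m * u $ 2)\<^sup>2"
    by algebra
  then have "(e * A + p * u $ 2 + m * u $ 3)\<^sup>2 \<le> (e\<^sup>2 + p\<^sup>2 + m\<^sup>2) * (A\<^sup>2 + (u $ 2)\<^sup>2 + (u $ 3)\<^sup>2)"
    by (smt (verit) zero_le_power2)
  also have "\<dots> = (e\<^sup>2 + p\<^sup>2 + m\<^sup>2) * (u $ 1)\<^sup>2"
    by (simp add: A)
  also have "\<dots> = (dual_norm e l m s * u $ 1)\<^sup>2"
    by (simp add: dual_norm_def p_def power_mult_distrib)
  finally show ?thesis
    unfolding A_def p_def by (rule power2_le_imp_le) (simp add: dual_norm_nonneg u1)
qed

text \<open>Weak duality. The case \<open>e = 1\<close> bounds the length; the case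
  \<open>e = 0\<close> says that H is nonnegative as soon as some trajectory exists.\<close>

lemma J_le_dual_value:
  assumes adm: "admissible_from_to q0 q1 T q u" and e: "0 \<le> e"
  shows "e * J T u \<le> dual_value q0 q1 e l m"
proof -
  have c: "u t \<in> control_set" if "t \<in> {0..T}" for t
    using adm that by (auto simp: admissible_from_to_def admissible_def)
  have b: "e * sqrt ((u t $ 1)\<^sup>2 - (u t $ 2)\<^sup>2 - (u t $ 3)\<^sup>2)
      \<le> dual_norm e l m (q t $ 1) * u t $ 1 - (l + m * q t $ 1) * u t $ 2 - m * u t $ 3"
    "0 \<le> e * sqrt ((u t $ 1)\<^sup>2 - (u t $ 2)\<^sup>2 - (u t $ 3)\<^sup>2)" if "t \<in> {0..T}" for t
    using dual_norm_control_bound[OF c[OF that], of e l m "q t $ 1"] e c[OF that]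
    by (auto simp: control_set_def)
  have "e * J T u = (LINT t|lebesgue_on {0..T}. e * sqrt ((u t $ 1)\<^sup>2 - (u t $ 2)\<^sup>2 - (u t $ 3)\<^sup>2))"
    by (simp add: J_def)
  also have "\<dots> \<le> (LINT t|lebesgue_on {0..T}.
      dual_norm e l m (q t $ 1) * u t $ 1 - (l + m * q t $ 1) * u t $ 2 - m * u t $ 3)"
    by (rule integral_mono'[OF trajectory_dual_value(1)[OF adm]])
       (use b in \<open>force intro: order_trans[OF b(2) b(1)]\<close>)+
  finally show ?thesis
    by (simp add: trajectory_dual_value(2)[OF adm])
qed

text \<open>A zero of the support-function gap exposes the endpoint constraints as a supporting hyperplane,
  which forces every admissible control onto the light cone.\<close>

lemma J_eq_0_of_degenerate:
  assumes adm: "admissible_from_to q0 q1 T q u"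
    and zero: "dual_value q0 q1 0 l m = 0" and lm: "(l, m) \<noteq> 0"
  shows "J T u = 0"
proof -
  let ?g = "\<lambda>t. dual_norm 0 l m (q t $ 1) * u t $ 1 - (l + m * q t $ 1) * u t $ 2 - m * u t $ 3"
  have c: "u t \<in> control_set" if "t \<in> {0..T}" for t
    using adm that by (auto simp: admissible_from_to_def admissible_def)
  have "AE t in lebesgue_on {0..T}. 0 \<le> ?g t"
    by (rule AE_I2) (use dual_norm_control_bound[OF c, of _ 0 l m] in \<open>force simp: algebra_simps\<close>)
  \<comment> \<open>A nonnegative integrand with integral zero vanishes almost everywhere, which is
    equality in the cone inequality.\<close>
  then have "AE t in lebesgue_on {0..T}. ?g t = 0"
    using integral_nonneg_eq_0_iff_AE[OF trajectory_dual_value(1)[OF adm, of 0 l m]]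
      trajectory_dual_value(2)[OF adm, of 0 l m] zero by simp
  then have "AE t in lebesgue_on {0..T}. sqrt ((u t $ 1)\<^sup>2 - (u t $ 2)\<^sup>2 - (u t $ 3)\<^sup>2) = 0"
    using AE_space
  proof eventually_elim
    case (elim t)
    define p where "p = l + m * q t $ 1"
    \<comment> \<open>If \<open>m = 0\<close> then \<open>p = l\<close>, so \<open>p\<close> and
      \<open>m\<close> cannot both vanish.\<close>
    have pm: "0 < p\<^sup>2 + m\<^sup>2"
      using lm by (auto simp: p_def sum_power2_gt_zero_iff zero_prod_def)
    have "(p\<^sup>2 + m\<^sup>2) * (u t $ 1)\<^sup>2 = (dual_norm 0 l m (q t $ 1) * u t $ 1)\<^sup>2"
      by (simp add: dual_norm_def p_def power_mult_distrib)
    also have "\<dots> = (p * u t $ 2 + m * u t $ 3)\<^sup>2"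
      using elim(1) by (simp add: p_def algebra_simps)
    also have "\<dots> = (p\<^sup>2 + m\<^sup>2) * ((u t $ 2)\<^sup>2 + (u t $ 3)\<^sup>2) - (p * u t $ 3 - m * u t $ 2)\<^sup>2"
      by algebra
    also have "\<dots> \<le> (p\<^sup>2 + m\<^sup>2) * ((u t $ 2)\<^sup>2 + (u t $ 3)\<^sup>2)"
      by simp
    finally have "(u t $ 1)\<^sup>2 \<le> (u t $ 2)\<^sup>2 + (u t $ 3)\<^sup>2"
      using pm by simp
    then show ?case
      using c[of t] elim(2) by (simp add: control_set_def)
  qed
  then show ?thesis
    unfolding J_def by (rule integral_eq_zero_AE)
qed

section \<open>Existence of optimal multipliers\<close>

lemma continuous_on_dual_value: "continuous_on UNIV (\<lambda>k. dual_value q0 q1 e (fst k) (snd k))"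
proof -
  have "continuous_on (UNIV \<times> cbox (q0 $ 1) (q1 $ 1)) (\<lambda>(k, s). dual_norm e (fst k) (snd k) s)"
    by (auto intro!: continuous_intros simp: case_prod_unfold)
  from integral_continuous_on_param[OF this] show ?thesis
    unfolding dual_value_def cbox_interval by (intro continuous_intros)
qed

lemma dual_norm_integrable: "dual_norm e l m integrable_on {a..b}"
  by (intro integrable_continuous_real continuous_on_dual_norm continuous_on_const continuous_on_id)

lemma dual_value_0_le: "dual_value q0 q1 0 l m \<le> dual_value q0 q1 e l m"
  unfolding dual_value_def
  by (intro diff_right_mono integral_le dual_norm_integrable) (auto simp: dual_norm_def)

lemma dual_value_0_scale:
  assumes "0 \<le> r"
  shows "dual_value q0 q1 0 (r * l) (r * m) = r * dual_value q0 q1 0 l m"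
proof -
  have "dual_norm 0 (r * l) (r * m) = (\<lambda>s. r * dual_norm 0 l m s)"
  proof
    fix s
    have "(r * l + r * m * s)\<^sup>2 + (r * m)\<^sup>2 = r\<^sup>2 * ((l + m * s)\<^sup>2 + m\<^sup>2)"
      by algebra
    then show "dual_norm 0 (r * l) (r * m) s = r * dual_norm 0 l m s"
      using assms by (simp add: dual_norm_def real_sqrt_mult)
  qed
  then show ?thesis
    unfolding dual_value_def by (simp add: right_diff_distrib)
qed

text \<open>By homogeneity \<open>H v\<close> is at least \<open>norm v\<close> times the minimum of
  \<open>H\<close> on the unit sphere, which is positive. Outside the ball of radius
  \<open>R\<close> this already exceeds \<open>D 0\<close>, so the minimum over the compact ball is
  global.\<close>

lemma coercive_attains_minimum:
  fixes D H :: "'a::euclidean_space \<Rightarrow> real"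
  assumes D: "continuous_on UNIV D" and H: "continuous_on UNIV H" and le: "\<And>v. H v \<le> D v"
    and scale: "\<And>r v. 0 \<le> r \<Longrightarrow> H (r *\<^sub>R v) = r * H v" and pos: "\<And>v. v \<noteq> 0 \<Longrightarrow> 0 < H v"
  obtains k where "\<And>v. D k \<le> D v"
proof -
  have "\<exists>v\<in>sphere 0 1. \<forall>w\<in>sphere 0 1. H v \<le> H w"
    by (rule continuous_attains_inf) (auto intro: continuous_on_subset[OF H])
  then obtain v0 where v0: "norm v0 = 1" "\<And>w. norm w = 1 \<Longrightarrow> H v0 \<le> H w"
    by auto
  have c: "0 < H v0"
    using v0(1) by (intro pos) auto
  define R where "R = \<bar>D 0\<bar> / H v0"
  have R: "0 \<le> R"
    using c by (simp add: R_def)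
  have "\<exists>k\<in>cball 0 R. \<forall>v\<in>cball 0 R. D k \<le> D v"
    by (rule continuous_attains_inf) (use R in \<open>auto intro: continuous_on_subset[OF D]\<close>)
  then obtain k where "\<forall>v\<in>cball 0 R. D k \<le> D v"
    by blast
  then have k: "D k \<le> D v" if "norm v \<le> R" for v
    using that by simp
  have "D k \<le> D v" if "R < norm v" for v
  proof -
    have v: "0 < norm v"
      using R that by linarith
    have "D k \<le> R * H v0"
      using k[of 0] R c by (simp add: R_def)
    also have "\<dots> \<le> norm v * H ((1 / norm v) *\<^sub>R v)"
      using that R c v v0(2)[of "(1 / norm v) *\<^sub>R v"] by (intro mult_mono) auto
    also have "\<dots> = H v"
      using v scale[of "norm v" "(1 / norm v) *\<^sub>R v"] by simp
    finally show ?thesis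
      using le[of v] by simp
  qed
  then show ?thesis
    using k that by (meson not_le)
qed

section \<open>First-order conditions for the multipliers\<close>

lemma dual_norm_pos:
  assumes "e \<noteq> 0"
  shows "0 < dual_norm e l m s"
  using assms by (simp add: dual_norm_def add_pos_nonneg)

lemma dual_norm_derivatives:
  assumes "e \<noteq> 0"
  shows "((\<lambda>l. dual_norm e l m s) has_real_derivative (l + m * s) / dual_norm e l m s) (at l within S)"
    and "((\<lambda>m. dual_norm e l m s) has_real_derivative ((l + m * s) * s + m) / dual_norm e l m s) (at m within S)"
proof -
  have "0 < e\<^sup>2 + (l + m * s)\<^sup>2 + m\<^sup>2"
    using assms by (simp add: add_pos_nonneg)
  then show "((\<lambda>l. dual_norm e l m s) has_real_derivative (l + m * s) / dual_norm e l m s) (at l within S)"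
    and "((\<lambda>m. dual_norm e l m s) has_real_derivative ((l + m * s) * s + m) / dual_norm e l m s) (at m within S)"
    unfolding dual_norm_def
    by (auto intro!: derivative_eq_intros simp: field_simps)
qed

text \<open>Differentiation under the integral sign in each multiplier; with \<open>e = 1\<close>
  the root stays positive, so the partial derivatives are continuous. The two integrals are the
  gains in y and in sheared height of the candidate curve.\<close>

lemma dual_value_stationary:
  assumes min: "\<And>l' m'. dual_value q0 q1 1 l m \<le> dual_value q0 q1 1 l' m'"
  shows "integral {q0 $ 1..q1 $ 1} (\<lambda>s. (l + m * s) / dual_norm 1 l m s) = q1 $ 2 - q0 $ 2"
    and "integral {q0 $ 1..q1 $ 1} (\<lambda>s. ((l + m * s) * s + m) / dual_norm 1 l m s)
      = sheared_height q1 - sheared_height q0"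
proof -
  have ne: "dual_norm 1 l m s \<noteq> 0" for l m s
    using dual_norm_pos[of 1 l m s] by simp
  have "((\<lambda>l. integral (cbox (q0 $ 1) (q1 $ 1)) (dual_norm 1 l m)) has_real_derivative
      integral (cbox (q0 $ 1) (q1 $ 1)) (\<lambda>s. (l + m * s) / dual_norm 1 l m s)) (at l within UNIV)"
    by (rule leibniz_rule_field_derivative[where fx = "\<lambda>l s. (l + m * s) / dual_norm 1 l m s"])
       (auto intro!: dual_norm_derivatives dual_norm_integrable continuous_intros simp: case_prod_unfold ne)
  then have "((\<lambda>l. dual_value q0 q1 1 l m) has_real_derivative
      integral {q0 $ 1..q1 $ 1} (\<lambda>s. (l + m * s) / dual_norm 1 l m s) - (q1 $ 2 - q0 $ 2)) (at l)"
    unfolding dual_value_def cbox_interval by (auto intro!: derivative_eq_intros)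
  from DERIV_local_min[OF this zero_less_one] min
  show "integral {q0 $ 1..q1 $ 1} (\<lambda>s. (l + m * s) / dual_norm 1 l m s) = q1 $ 2 - q0 $ 2"
    by simp
  have "((\<lambda>m. integral (cbox (q0 $ 1) (q1 $ 1)) (dual_norm 1 l m)) has_real_derivative
      integral (cbox (q0 $ 1) (q1 $ 1)) (\<lambda>s. ((l + m * s) * s + m) / dual_norm 1 l m s)) (at m within UNIV)"
    by (rule leibniz_rule_field_derivative[where fx = "\<lambda>m s. ((l + m * s) * s + m) / dual_norm 1 l m s"])
       (auto intro!: dual_norm_derivatives dual_norm_integrable continuous_intros simp: case_prod_unfold ne)
  then have "((\<lambda>m. dual_value q0 q1 1 l m) has_real_derivative
      integral {q0 $ 1..q1 $ 1} (\<lambda>s. ((l + m * s) * s + m) / dual_norm 1 l m s)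
        - (sheared_height q1 - sheared_height q0)) (at m)"
    unfolding dual_value_def cbox_interval by (auto intro!: derivative_eq_intros)
  from DERIV_local_min[OF this zero_less_one] min
  show "integral {q0 $ 1..q1 $ 1} (\<lambda>s. ((l + m * s) * s + m) / dual_norm 1 l m s)
      = sheared_height q1 - sheared_height q0"
    by simp
qed

section \<open>Construction of the maximiser from the multipliers\<close>

lemma vector_3_eq_axis:
  "(vector [a, b, c] :: real ^ 3) = a *\<^sub>R axis 1 1 + b *\<^sub>R axis 2 1 + c *\<^sub>R axis 3 1"
  by (simp add: vec_eq_iff forall_3 axis_def)

lemma has_vector_derivative_vector_3:
  assumes "(f has_real_derivative f') (at t within S)" "(g has_real_derivative g') (at t within S)"
    "(h has_real_derivative h') (at t within S)"
  shows "((\<lambda>t. vector [f t, g t, h t] :: real ^ 3) has_vector_derivative vector [f', g', h']) (at t within S)"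
  unfolding vector_3_eq_axis
  using assms by (auto intro!: derivative_eq_intros)

lemma continuous_on_vector_3:
  fixes f g h :: "'a::topological_space \<Rightarrow> real"
  assumes "continuous_on S f" "continuous_on S g" "continuous_on S h"
  shows "continuous_on S (\<lambda>t. vector [f t, g t, h t] :: real ^ 3)"
  unfolding vector_3_eq_axis using assms by (intro continuous_intros)

lemma C1_imp_lipschitz_on:
  fixes q :: "real \<Rightarrow> 'a::real_normed_vector"
  assumes d: "\<And>t. t \<in> {a..b} \<Longrightarrow> (q has_vector_derivative q' t) (at t within {a..b})"
    and c: "continuous_on {a..b} q'"
  obtains L where "L-lipschitz_on {a..b} q"
proof -
  have "bounded (q' ` {a..b})"
    by (intro compact_imp_bounded compact_continuous_image c) auto
  then obtain L where L: "0 < L" "\<And>t. t \<in> {a..b} \<Longrightarrow> norm (q' t) \<le> L"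
    unfolding bounded_pos by blast
  have "L-lipschitz_on {a..b} q"
    by (rule bounded_derivative_imp_lipschitz[OF d[unfolded has_vector_derivative_def]])
       (use L in \<open>auto intro!: onorm_le mult_left_mono simp: mult.commute[of L]\<close>)
  then show ?thesis ..
qed

text \<open>Moving at unit speed in x with control (1, v2, v3) makes (1, l + m x, m) a multiple of
  (A, v2, v3), with A the length of the control. Cauchy-Schwarz is then an equality at every time
  and the bound is attained, while \<open>y1\<close> and \<open>w1\<close> place the end
  point.\<close>

lemma stationary_trajectory:
  assumes le: "q0 $ 1 \<le> q1 $ 1"
    and y1: "integral {q0 $ 1..q1 $ 1} (\<lambda>s. (l + m * s) / dual_norm 1 l m s) = q1 $ 2 - q0 $ 2"
    and w1: "integral {q0 $ 1..q1 $ 1} (\<lambda>s. ((l + m * s) * s + m) / dual_norm 1 l m s)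
      = sheared_height q1 - sheared_height q0"
  obtains T q u where "admissible_from_to q0 q1 T q u" "J T u = dual_value q0 q1 1 l m"
proof -
  define T where "T = q1 $ 1 - q0 $ 1"
  define x where "x t = q0 $ 1 + t" for t
  define N where "N = dual_norm 1 l m"
  define v2 where "v2 s = (l + m * s) / N s" for s
  define v3 where "v3 s = m / N s" for s
  \<comment> \<open>The velocity x u2 + u3 of the sheared height.\<close>
  define c where "c s = ((l + m * s) * s + m) / N s" for s
  define y where "y t = q0 $ 2 + integral {q0 $ 1..x t} v2" for t
  \<comment> \<open>The height is recovered from the sheared height by undoing the shear.\<close>
  define z where "z t = sheared_height q0 + integral {q0 $ 1..x t} c - x t * y t / 2" for t
  define u :: "real \<Rightarrow> real ^ 3" where "u t = vector [1, v2 (x t), v3 (x t)]" for t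
  define q :: "real \<Rightarrow> heis" where "q t = vector [x t, y t, z t]" for t
  have N: "0 < N s" for s
    by (simp add: N_def dual_norm_pos)
  then have ne: "N s \<noteq> 0" for s
    by (metis less_irrefl)
  have c_eq: "c s = s * v2 s + v3 s" for s
    using ne[of s] by (simp add: c_def v2_def v3_def field_simps)
  have cN [continuous_intros]: "continuous_on S N" for S
    unfolding N_def by (intro continuous_on_dual_norm continuous_on_const continuous_on_id)
  have cv: "continuous_on S v2" "continuous_on S v3" "continuous_on S c" for S
    unfolding v2_def v3_def c_def by (intro continuous_intros; simp add: ne)+
  have cx: "continuous_on S x" for S
    unfolding x_def by (intro continuous_intros)
  have xim: "x ` {0..T} = {q0 $ 1..q1 $ 1}"
    by (simp add: x_def T_def image_add_atLeastAtMost)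
  have dx: "(x has_real_derivative 1) (at t within S)" for t S
    unfolding x_def by (auto intro!: derivative_eq_intros)
  have dint: "((\<lambda>t. integral {q0 $ 1..x t} f) has_real_derivative f (x t)) (at t within {0..T})"
    if f: "continuous_on {q0 $ 1..q1 $ 1} f" and t: "t \<in> {0..T}" for f t
  proof -
    have "x t \<in> {q0 $ 1..q1 $ 1}"
      using t xim by blast
    from integral_has_real_derivative[OF f this]
    have "((\<lambda>s. integral {q0 $ 1..s} f) has_real_derivative f (x t)) (at (x t) within x ` {0..T})"
      by (simp add: xim)
    from DERIV_image_chain[OF this dx] show ?thesis
      by (simp add: o_def)
  qed
  have dy: "(y has_real_derivative v2 (x t)) (at t within {0..T})" if "t \<in> {0..T}" for t
    unfolding y_def using dint[OF cv(1) that] by (auto intro!: derivative_eq_intros)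
  have dz: "(z has_real_derivative - y t / 2 + x t / 2 * v2 (x t) + v3 (x t)) (at t within {0..T})"
    if "t \<in> {0..T}" for t
    unfolding z_def using dint[OF cv(3) that] dy[OF that] dx
    by (auto intro!: derivative_eq_intros simp: c_eq field_simps)
  let ?V = "\<lambda>t. u t $ 1 *\<^sub>R X1 (q t) + u t $ 2 *\<^sub>R X2 (q t) + u t $ 3 *\<^sub>R X3 (q t)"
  have V: "?V t = vector [1, v2 (x t), - y t / 2 + x t / 2 * v2 (x t) + v3 (x t)]" for t
    by (simp add: u_def q_def X1_def X2_def X3_def vec_eq_iff forall_3 mult.commute)
  have dq: "(q has_vector_derivative ?V t) (at t within {0..T})" if "t \<in> {0..T}" for t
    unfolding V unfolding q_def
    by (intro has_vector_derivative_vector_3 dx dy dz that)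
  have cvx: "continuous_on S (\<lambda>t. v2 (x t))" "continuous_on S (\<lambda>t. v3 (x t))" for S
    using continuous_on_compose2[OF cv(1)[of UNIV] cx] continuous_on_compose2[OF cv(2)[of UNIV] cx] by auto
  have cy: "continuous_on {0..T} y"
    by (rule DERIV_continuous_on[OF dy])
  have "continuous_on {0..T} ?V"
    unfolding V by (intro continuous_on_vector_3 continuous_intros cvx cy cx) auto
  from C1_imp_lipschitz_on[OF dq this] obtain L where L: "L-lipschitz_on {0..T} q"
    by blast
  have cu: "continuous_on {0..T} u"
    unfolding u_def by (intro continuous_on_vector_3 continuous_on_const cvx)
  have um: "u \<in> borel_measurable (lebesgue_on {0..T})"
    by (rule continuous_imp_measurable_on_sets_lebesgue[OF cu]) auto
  have "bounded (u ` {0..T})"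
    by (intro compact_imp_bounded compact_continuous_image cu) auto
  then obtain C where "\<And>t. t \<in> {0..T} \<Longrightarrow> norm (u t) \<le> C"
    unfolding bounded_iff by blast
  then have C: "AE t in lebesgue_on {0..T}. norm (u t) \<le> C"
    by (intro AE_I2) auto
  \<comment> \<open>The control is timelike, with Lorentzian length \<open>1 / N s\<close>.\<close>
  have sq: "(v2 s)\<^sup>2 + (v3 s)\<^sup>2 = 1 - (1 / N s)\<^sup>2" for s
  proof -
    have "(N s)\<^sup>2 = 1 + (l + m * s)\<^sup>2 + m\<^sup>2"
      by (simp add: N_def dual_norm_def)
    then have "(l + m * s)\<^sup>2 + m\<^sup>2 = (N s)\<^sup>2 - 1"
      by simp
    then show ?thesis
      using ne[of s] by (simp add: v2_def v3_def power_divide diff_divide_distrib flip: add_divide_distrib)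
  qed
  have "(v2 s)\<^sup>2 + (v3 s)\<^sup>2 \<le> 1" for s
    unfolding sq by simp
  then have ctrl: "u t \<in> control_set" for t
    by (simp add: control_set_def u_def algebra_simps)
  have "q 0 = q0"
    by (simp add: q_def z_def y_def x_def sheared_height_def vec_eq_iff forall_3)
  moreover have "q T = q1"
    using y1 w1
    by (simp add: q_def z_def y_def x_def T_def v2_def[abs_def] c_def[abs_def] N_def sheared_height_def vec_eq_iff forall_3)
  ultimately have adm: "admissible_from_to q0 q1 T q u"
    unfolding admissible_from_to_def admissible_def
    using le L um C ctrl dq by (auto simp: T_def intro!: AE_I2)
  \<comment> \<open>The equality case of \<open>dual_norm_control_bound\<close>, pointwise along the
    curve.\<close>
  have "J T u = (LINT t|lebesgue_on {0..T}.
      dual_norm 1 l m (q t $ 1) * u t $ 1 - (l + m * q t $ 1) * u t $ 2 - m * u t $ 3)"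
    unfolding J_def
  proof (rule Bochner_Integration.integral_cong[OF refl])
    fix t
    have "(l + m * x t) * v2 (x t) + m * v3 (x t) = N (x t) * ((v2 (x t))\<^sup>2 + (v3 (x t))\<^sup>2)"
      using ne[of "x t"] by (simp add: v2_def v3_def field_simps power2_eq_square)
    also have "\<dots> = N (x t) - 1 / N (x t)"
      unfolding sq using ne[of "x t"] by (simp add: field_simps power2_eq_square)
    finally have "N (x t) - (l + m * x t) * v2 (x t) - m * v3 (x t) = 1 / N (x t)"
      by simp
    moreover have "1 - (v2 (x t))\<^sup>2 - (v3 (x t))\<^sup>2 = (1 / N (x t))\<^sup>2"
      using sq[of "x t"] by simp
    ultimately show "sqrt ((u t $ 1)\<^sup>2 - (u t $ 2)\<^sup>2 - (u t $ 3)\<^sup>2) =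
        dual_norm 1 l m (q t $ 1) * u t $ 1 - (l + m * q t $ 1) * u t $ 2 - m * u t $ 3"
      using N[of "x t"] by (simp add: u_def q_def N_def[symmetric] less_imp_le)
  qed
  then have "J T u = dual_value q0 q1 1 l m"
    by (simp add: trajectory_dual_value(2)[OF adm])
  with adm show ?thesis ..
qed

theorem mainTheorem3:
  fixes q0 q1 :: heis
  assumes "q1 \<in> attainable_set q0"
  shows "\<exists>t1 q u. longest_curve q0 q1 t1 q u"
proof -
  from assms obtain t1 q u where adm: "admissible_from_to q0 q1 t1 q u"
    by (auto simp: attainable_set_def)
  show ?thesis
  proof (cases "\<exists>l m. (l, m) \<noteq> 0 \<and> dual_value q0 q1 0 l m = 0")
    case True
    then obtain l m where "dual_value q0 q1 0 l m = 0" "(l, m) \<noteq> 0"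
      by blast
    then have "J T v = 0" if "admissible_from_to q0 q1 T p v" for T p v
      using J_eq_0_of_degenerate[OF that] by blast
    \<comment> \<open>All lengths are zero, so the given trajectory is already a longest
      one.\<close>
    then show ?thesis
      using adm unfolding longest_curve_def by (metis order_refl)
  next
    case False
    let ?D = "\<lambda>e k. dual_value q0 q1 e (fst k) (snd k)"
    \<comment> \<open>Weak duality with \<open>e = 0\<close> along the given trajectory yields
      nonnegativity, and the case assumption excludes zero.\<close>
    have pos: "0 < ?D 0 k" if "k \<noteq> 0" for k
      using J_le_dual_value[OF adm order_refl, of "fst k" "snd k"] False that
      by (cases k) (force simp: less_le)
    obtain k where k: "\<And>k'. ?D 1 k \<le> ?D 1 k'"
      by (rule coercive_attains_minimum[of "?D 1" "?D 0"])
         (auto simp: continuous_on_dual_value dual_value_0_le dual_value_0_scale pos)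
    have "?D 1 k \<le> dual_value q0 q1 1 l m" for l m
      using k[of "(l, m)"] by simp
    note stat = dual_value_stationary[OF this]
    obtain T p v where "admissible_from_to q0 q1 T p v" "J T v = ?D 1 k"
      using stationary_trajectory[OF trajectory_monotone[OF adm] stat] by blast
    \<comment> \<open>The constructed curve has length equal to a bound valid for all
      competitors.\<close>
    then have "longest_curve q0 q1 T p v"
      unfolding longest_curve_def
      using J_le_dual_value[of q0 q1 _ _ _ 1] by fastforce
    then show ?thesis
      by blast
  qed
qed

end
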